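(* For each $n\in\mathbb{N}=\{0,1,2,\dots\}$, the functor $\mathcal{P}^{(n)}\colon\mathbf{Digraph}\to\mathbf{Digraph}$, $\mathcal{G}\mapsto\mathcal{PG}^{(n)}$, restricts to a functor $\mathbf{Digraph}_0\to\mathbf{Digraph}_0$ on the category of finite digraphs without oriented cycles.
   Context: A digraph is a pair $\mathcal{G}=(V,E)$ with $V$ a finite set of vertices and $E\subseteq (V\times V)\setminus\{(v,v): v\in V\}$ a set of directed edges (no loops; reciprocal edges $(v,w),(w,v)$ are both allowed; the empty digraph is allowed). A morphism of digraphs $(V_1,E_1)\to(V_2,E_2)$ is a function $\phi\colon V_1\to V_2$ such that $(\phi(v),\phi(w))\in E_2$ for every $(v,w)\in E_1$. Finite digraphs and these morphisms form the category $\mathbf{Digraph}$. An oriented cycle in a digraph is an embedded copy of the coherently oriented cyclic digraph $C_m$, $m\ge 2$, with distinct vertices $v_1,\dots,v_m$ and edges $(v_1,v_2),\dots,(v_{m-1},v_m),(v_m,v_1)$. $\mathbf{Digraph}_0$ is the full subcategory of $\mathbf{Digraph}$ on digraphs without oriented cycles. The directed flag complex $\mathrm{dFl}(\mathcal{G})$ has as $k$-simplices the ordered $(k+1)$-cliques of $\mathcal{G}$, i.e. tuples $[v_0,\dots,v_k]$ of vertices with $(v_i,v_j)\in E$ for all $i<j$. The face map $d_j$ deletes the $j$-th entry: $d_j[v_0,\dots,v_k]=[v_0,\dots,\widehat{v_j},\dots,v_k]$, $0\le j\le k$. For $n\ge 1$, the $n$-path digraph $\mathcal{PG}^{(n)}$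 of $\mathcal{G}$ has as vertices the $n$-simplices of $\mathrm{dFl}(\mathcal{G})$, and there is a directed edge $(\sigma,\tau)$ if and only if there are an $(n-1)$-simplex $\alpha$ of $\mathrm{dFl}(\mathcal{G})$ and $i,j\in\{0,\dots,n\}$ with $i<j$ such that $d_i(\sigma)=\alpha=d_j(\tau)$. For $n=0$, $\mathcal{PG}^{(0)}=\mathcal{G}$. On a morphism $\phi\colon\mathcal{G}_1\to\mathcal{G}_2$, $\mathcal{P}^{(n)}(\phi)$ is given on vertices by $[v_0,\dots,v_n]\mapsto[\phi(v_0),\dots,\phi(v_n)]$ (and $\mathcal{P}^{(0)}(\phi)=\phi$). *)

theory Defs
  imports "HOL-Library.FuncSet" "Graph_Theory.Pair_Digraph"
begin

section \<open>Categories and functors\<close>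

text \<open>
  Categories are given by hom-sets indexed by objects: \<open>Comp C X Y Z g f\<close> is the composite of
  \<open>f \<in> Hom C X Y\<close> and \<open>g \<in> Hom C Y Z\<close>.  Hom-sets need not be disjoint, so composition and the
  morphism part of a functor take the objects as arguments.
\<close>

record ('o, 'm) category_data =
  Ob :: "'o set"
  Hom :: "'o \<Rightarrow> 'o \<Rightarrow> 'm set"
  Id :: "'o \<Rightarrow> 'm"
  Comp :: "'o \<Rightarrow> 'o \<Rightarrow> 'o \<Rightarrow> 'm \<Rightarrow> 'm \<Rightarrow> 'm"

locale category =
  fixes C :: "('o, 'm) category_data"
  assumes id_in_hom: "X \<in> Ob C \<Longrightarrow> Id C X \<in> Hom C X X"
    and comp_in_hom: "\<lbrakk>X \<in> Ob C; Y \<in> Ob C; Z \<in> Ob C; f \<in> Hom C X Y; g \<in> Hom C Y Z\<rbrakk>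
      \<Longrightarrow> Comp C X Y Z g f \<in> Hom C X Z"
    and comp_id_right: "\<lbrakk>X \<in> Ob C; Y \<in> Ob C; f \<in> Hom C X Y\<rbrakk>
      \<Longrightarrow> Comp C X X Y f (Id C X) = f"
    and comp_id_left: "\<lbrakk>X \<in> Ob C; Y \<in> Ob C; f \<in> Hom C X Y\<rbrakk>
      \<Longrightarrow> Comp C X Y Y (Id C Y) f = f"
    and comp_assoc: "\<lbrakk>W \<in> Ob C; X \<in> Ob C; Y \<in> Ob C; Z \<in> Ob C;
        f \<in> Hom C W X; g \<in> Hom C X Y; h \<in> Hom C Y Z\<rbrakk>
      \<Longrightarrow> Comp C W X Z (Comp C X Y Z h g) f = Comp C W Y Z h (Comp C W X Y g f)"

locale category_functor = dom: category C + cod: category D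
  for C :: "('o, 'm) category_data" and D :: "('p, 'q) category_data" +
  fixes F_ob :: "'o \<Rightarrow> 'p" and F_mor :: "'o \<Rightarrow> 'o \<Rightarrow> 'm \<Rightarrow> 'q"
  assumes map_ob: "X \<in> Ob C \<Longrightarrow> F_ob X \<in> Ob D"
    and map_hom: "\<lbrakk>X \<in> Ob C; Y \<in> Ob C; f \<in> Hom C X Y\<rbrakk>
      \<Longrightarrow> F_mor X Y f \<in> Hom D (F_ob X) (F_ob Y)"
    and map_id: "X \<in> Ob C \<Longrightarrow> F_mor X X (Id C X) = Id D (F_ob X)"
    and map_comp: "\<lbrakk>X \<in> Ob C; Y \<in> Ob C; Z \<in> Ob C; f \<in> Hom C X Y; g \<in> Hom C Y Z\<rbrakk>
      \<Longrightarrow> F_mor X Z (Comp C X Y Z g f) =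
          Comp D (F_ob X) (F_ob Y) (F_ob Z) (F_mor Y Z g) (F_mor X Y f)"

definition full_subcategory :: "('o, 'm) category_data \<Rightarrow> ('o \<Rightarrow> bool) \<Rightarrow> ('o, 'm) category_data"
  where "full_subcategory C P = C\<lparr>Ob := {X \<in> Ob C. P X}\<rparr>"

section \<open>The category of finite digraphs\<close>

text \<open>
  The vertices of a path digraph are tuples of vertices of the original digraph.  In order to have
  one category of digraphs on which the path digraph construction is an endofunctor, vertices are
  taken from a universe closed under tuples.  Any digraph with vertices of type \<open>'a\<close> is a digraph
  over this universe via \<open>Atom\<close>.
\<close>

datatype 'a vertex = Atom 'a | Tuple (entries: "'a vertex list")

text \<open>
  A morphism is a function on the vertex set, encoded as a function that is \<open>undefined\<close> outside
  of it, so that equality of morphisms is equality of HOL functions.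
\<close>

definition digraph_hom :: "'v pair_pre_digraph \<Rightarrow> 'v pair_pre_digraph \<Rightarrow> ('v \<Rightarrow> 'v) set" where
  "digraph_hom G H = {\<phi> \<in> pverts G \<rightarrow>\<^sub>E pverts H. \<forall>(v, w) \<in> parcs G. (\<phi> v, \<phi> w) \<in> parcs H}"

text \<open>The locale \<open>pair_digraph\<close> describes finite (possibly empty) digraphs without loops.\<close>

definition Digraph :: "('v pair_pre_digraph, 'v \<Rightarrow> 'v) category_data" where
  "Digraph = \<lparr>Ob = {G. pair_digraph G}, Hom = digraph_hom,
     Id = (\<lambda>G. \<lambda>v\<in>pverts G. v), Comp = (\<lambda>G H K \<psi> \<phi>. compose (pverts G) \<psi> \<phi>)\<rparr>"

text \<open>
  In \<open>Graph_Theory\<close>, a cycle is a non-empty closed walk repeating no vertex other than its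
  endpoint.  In a digraph without loops it has length at least 2.
\<close>

definition has_oriented_cycle :: "'v pair_pre_digraph \<Rightarrow> bool" where
  "has_oriented_cycle G \<longleftrightarrow> (\<exists>p. pre_digraph.cycle (with_proj G) p)"

definition Digraph0 :: "('v pair_pre_digraph, 'v \<Rightarrow> 'v) category_data" where
  "Digraph0 = full_subcategory Digraph (\<lambda>G. \<not> has_oriented_cycle G)"

section \<open>Path digraphs\<close>

definition dfl_simplices :: "'v pair_pre_digraph \<Rightarrow> nat \<Rightarrow> 'v list set" where
  "dfl_simplices G k = {\<sigma>. length \<sigma> = k + 1 \<and> set \<sigma> \<subseteq> pverts G \<and>
     (\<forall>i j. i < j \<and> j \<le> k \<longrightarrow> (\<sigma> ! i, \<sigma> ! j) \<in> parcs G)}"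

definition face :: "nat \<Rightarrow> 'v list \<Rightarrow> 'v list" where
  "face j \<sigma> = take j \<sigma> @ drop (Suc j) \<sigma>"

definition path_digraph :: "nat \<Rightarrow> 'a vertex pair_pre_digraph \<Rightarrow> 'a vertex pair_pre_digraph" where
  "path_digraph n G = (if n = 0 then G else
     \<lparr>pverts = Tuple ` dfl_simplices G n,
      parcs = {(Tuple \<sigma>, Tuple \<tau>) | \<sigma> \<tau>. \<sigma> \<in> dfl_simplices G n \<and> \<tau> \<in> dfl_simplices G n \<and>
        (\<exists>\<alpha> \<in> dfl_simplices G (n - 1). \<exists>i j. i < j \<and> j \<le> n \<and> face i \<sigma> = \<alpha> \<and> \<alpha> = face j \<tau>)}\<rparr>)"

text \<open>
  The target \<open>H\<close> is not needed; it is an argument to fit the type of the morphism part of a functor.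
\<close>

definition path_morphism :: "nat \<Rightarrow> 'a vertex pair_pre_digraph \<Rightarrow> 'a vertex pair_pre_digraph \<Rightarrow>
    ('a vertex \<Rightarrow> 'a vertex) \<Rightarrow> ('a vertex \<Rightarrow> 'a vertex)" where
  "path_morphism n G H \<phi> = (if n = 0 then \<phi> else
     (\<lambda>v \<in> pverts (path_digraph n G). Tuple (map \<phi> (entries v))))"

end

(* A finite digraph without oriented cycles carries a potential h on its vertices which increases
   along arcs.  If face i s = face j t with i < j, then t arises from s by deleting the entry s ! i
   and inserting t ! j.  Since t ! (j - 1) = s ! j, there are arcs from s ! i to s ! j and from there
   to t ! j, so the sum of h over the entries increases along the arcs of the path digraph. *)

theory Submission
  imports Defs
begin

section \<open>Full subcategories\<close>

lemma full_subcategory_simps [simp]: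
  "Ob (full_subcategory C P) = {X \<in> Ob C. P X}"
  "Hom (full_subcategory C P) = Hom C"
  "Id (full_subcategory C P) = Id C"
  "Comp (full_subcategory C P) = Comp C"
  by (simp_all add: full_subcategory_def)

lemma (in category) category_full_subcategory: "category (full_subcategory C P)"
  by unfold_locales
    (auto intro: id_in_hom comp_in_hom comp_id_right comp_id_left comp_assoc)

text \<open>Hom-sets, identities and composites are inherited, so a restriction only has to be
  checked on objects.\<close>

lemma (in category_functor) category_functor_full_subcategory:
  assumes "\<And>X. X \<in> Ob C \<Longrightarrow> P X \<Longrightarrow> Q (F_ob X)"
  shows "category_functor (full_subcategory C P) (full_subcategory D Q) F_ob F_mor"
  unfolding category_functor_def category_functor_axioms_def
  using assms dom.category_full_subcategory cod.category_full_subcategory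
  by (auto intro: map_ob map_hom map_id map_comp)

section \<open>The category of digraphs\<close>

lemma Digraph_simps [simp]:
  "Ob Digraph = {G. pair_digraph G}"
  "Hom Digraph = digraph_hom"
  "Id Digraph G = (\<lambda>v\<in>pverts G. v)"
  "Comp Digraph G H K \<psi> \<phi> = compose (pverts G) \<psi> \<phi>"
  by (simp_all add: Digraph_def)

lemma digraph_homI:
  assumes "\<phi> \<in> pverts G \<rightarrow>\<^sub>E pverts H"
    and "\<And>v w. (v, w) \<in> parcs G \<Longrightarrow> (\<phi> v, \<phi> w) \<in> parcs H"
  shows "\<phi> \<in> digraph_hom G H"
  using assms by (auto simp: digraph_hom_def)

lemma digraph_homD:
  assumes "\<phi> \<in> digraph_hom G H"
  shows "\<phi> \<in> pverts G \<rightarrow> pverts H" "\<phi> \<in> extensional (pverts G)"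
    and "\<And>v w. (v, w) \<in> parcs G \<Longrightarrow> (\<phi> v, \<phi> w) \<in> parcs H"
  using assms by (auto simp: digraph_hom_def PiE_def)

text \<open>Arcs have their endpoints in \<open>pverts G\<close>, so a map that is
  \<open>undefined\<close> elsewhere still takes its intended values on them. Composition rests on
  the same fact.\<close>

lemma (in pair_wf_digraph) id_in_digraph_hom: "(\<lambda>v\<in>pverts G. v) \<in> digraph_hom G G"
  by (rule digraph_homI) (auto simp: in_arcsD1 in_arcsD2)

lemma (in pair_wf_digraph) compose_in_digraph_hom:
  assumes "\<phi> \<in> digraph_hom G H" "\<psi> \<in> digraph_hom H K"
  shows "compose (pverts G) \<psi> \<phi> \<in> digraph_hom G K"
  using digraph_homD[OF assms(1)] digraph_homD[OF assms(2)]
  by (intro digraph_homI) (auto simp: compose_def in_arcsD1 in_arcsD2)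

lemma category_Digraph: "category Digraph"
proof
  fix X :: "'v pair_pre_digraph" assume "X \<in> Ob Digraph"
  then interpret pair_digraph X by simp
  show "Id Digraph X \<in> Hom Digraph X X"
    using id_in_digraph_hom by simp
next
  fix X Y Z :: "'v pair_pre_digraph" and f g
  assume "X \<in> Ob Digraph" and fg: "f \<in> Hom Digraph X Y" "g \<in> Hom Digraph Y Z"
  then interpret pair_digraph X by simp
  show "Comp Digraph X Y Z g f \<in> Hom Digraph X Z"
    using fg compose_in_digraph_hom by simp
next
  fix X Y :: "'v pair_pre_digraph" and f
  assume "f \<in> Hom Digraph X Y"
  \<comment> \<open>Off \<open>pverts X\<close> the composites are \<open>undefined\<close>; there
    the identity laws hold because \<open>f\<close> is extensional.\<close>
  then have "f \<in> pverts X \<rightarrow> pverts Y" "f \<in> extensional (pverts X)"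
    by (auto dest: digraph_homD)
  then show "Comp Digraph X X Y f (Id Digraph X) = f" "Comp Digraph X Y Y (Id Digraph Y) f = f"
    by (simp_all add: compose_Id Id_compose)
next
  fix W X Y Z :: "'v pair_pre_digraph" and f g h
  assume "f \<in> Hom Digraph W X" "g \<in> Hom Digraph X Y" "h \<in> Hom Digraph Y Z"
  then show "Comp Digraph W X Z (Comp Digraph X Y Z h g) f =
      Comp Digraph W Y Z h (Comp Digraph W X Y g f)"
    \<comment> \<open>\<open>f\<close> lands in \<open>pverts X\<close>, the set to which the
      composite of \<open>g\<close> and \<open>h\<close> is restricted.\<close>
    by (simp, metis compose_assoc digraph_homD(1))
qed

section \<open>Oriented cycles and potentials\<close>

text \<open>Every closed walk contains a cycle, and a non-empty walk from u back to u exists exactly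
  when \<open>(u, u)\<close> lies in the transitive closure of the arcs.\<close>

lemma (in pair_wf_digraph) has_oriented_cycle_iff:
  "has_oriented_cycle G \<longleftrightarrow> \<not> acyclic (parcs G)"
proof -
  have "has_oriented_cycle G \<longleftrightarrow> (\<exists>p. closed_w p)"
    unfolding has_oriented_cycle_def using closed_w_imp_cycle cycle_altdef by blast
  also have "\<dots> \<longleftrightarrow> (\<exists>u. (u, u) \<in> (parcs G)\<^sup>+)"
    unfolding closed_w_def reachable1_awalk by blast
  finally show ?thesis by (simp add: acyclic_def)
qed

text \<open>The potential of v is the number of vertices from which v can be reached in at least one
  step; they all lie in the finite \<open>Domain r\<close>.\<close>

lemma finite_acyclic_imp_potential:
  assumes "finite r" "acyclic r"
  obtains h :: "'v \<Rightarrow> nat" where "\<And>v w. (v, w) \<in> r \<Longrightarrow> h v < h w"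
proof
  fix v w assume vw: "(v, w) \<in> r"
  have "finite {u. (u, w) \<in> r\<^sup>+}"
    using assms(1) by (intro finite_subset[OF _ finite_Domain[of r]]) (auto dest: tranclD)
  \<comment> \<open>The inclusion is strict because of v: it precedes w, but by acyclicity not
    itself.\<close>
  moreover have "{u. (u, v) \<in> r\<^sup>+} \<subset> {u. (u, w) \<in> r\<^sup>+}"
    using vw assms(2) by (auto simp: acyclic_def intro: trancl_into_trancl)
  ultimately show "card {u. (u, v) \<in> r\<^sup>+} < card {u. (u, w) \<in> r\<^sup>+}"
    by (rule psubset_card_mono)
qed

lemma potential_imp_acyclic:
  fixes h :: "'v \<Rightarrow> nat"
  assumes "\<And>v w. (v, w) \<in> r \<Longrightarrow> h v < h w"
  shows "acyclic r"
proof (rule wf_acyclic)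
  have "r \<subseteq> measure h" using assms by auto
  then show "wf r" by (rule wf_subset[rotated]) simp
qed

section \<open>Simplices and faces\<close>

lemma length_dfl_simplex: "\<sigma> \<in> dfl_simplices G n \<Longrightarrow> length \<sigma> = Suc n"
  by (simp add: dfl_simplices_def)

lemma dfl_simplex_arc:
  "\<sigma> \<in> dfl_simplices G n \<Longrightarrow> i < j \<Longrightarrow> j \<le> n \<Longrightarrow> (\<sigma> ! i, \<sigma> ! j) \<in> parcs G"
  by (simp add: dfl_simplices_def)

lemma finite_dfl_simplices: "finite (pverts G) \<Longrightarrow> finite (dfl_simplices G n)"
  by (rule finite_subset[OF _ finite_lists_length_eq[of "pverts G" "n + 1"]])
    (auto simp: dfl_simplices_def)

text \<open>Being a simplex is a condition on arcs, which morphisms preserve, so no simplex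
  collapses to a lower dimension. This makes \<open>path_morphism\<close> well defined on
  vertices.\<close>

lemma map_dfl_simplex:
  assumes "\<phi> \<in> digraph_hom G H" "\<sigma> \<in> dfl_simplices G n"
  shows "map \<phi> \<sigma> \<in> dfl_simplices H n"
  using assms digraph_homD[OF assms(1)] by (auto simp: dfl_simplices_def)

lemma face_map: "face i (map f \<sigma>) = map f (face i \<sigma>)"
  by (simp add: face_def take_map drop_map)

lemma nth_face:
  assumes "j < length \<sigma>" "Suc k < length \<sigma>"
  shows "face j \<sigma> ! k = (if k < j then \<sigma> ! k else \<sigma> ! Suc k)"
  using assms by (auto simp: face_def nth_append)

text \<open>For two simplices with a common face, the face sums cancel and only the deleted entries
  need comparing.\<close>

lemma sum_list_map_face:
  fixes h :: "'v \<Rightarrow> nat"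
  assumes "j < length \<sigma>"
  shows "sum_list (map h \<sigma>) = sum_list (map h (face j \<sigma>)) + h (\<sigma> ! j)"
  by (subst id_take_nth_drop[OF assms]) (simp add: face_def)

section \<open>The path digraph functor\<close>

lemma path_digraph_0 [simp]: "path_digraph 0 G = G"
  by (simp add: path_digraph_def)

lemma pverts_path_digraph: "n \<noteq> 0 \<Longrightarrow> pverts (path_digraph n G) = Tuple ` dfl_simplices G n"
  by (simp add: path_digraph_def)

lemma path_digraph_arcE:
  assumes "n \<noteq> 0" "(v, w) \<in> parcs (path_digraph n G)"
  obtains \<sigma> \<tau> i j where "v = Tuple \<sigma>" "w = Tuple \<tau>"
    "\<sigma> \<in> dfl_simplices G n" "\<tau> \<in> dfl_simplices G n" "face i \<sigma> \<in> dfl_simplices G (n - 1)"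
    "i < j" "j \<le> n" "face i \<sigma> = face j \<tau>"
  using assms by (auto simp: path_digraph_def)

lemma path_digraph_arcI:
  assumes "n \<noteq> 0" "\<sigma> \<in> dfl_simplices G n" "\<tau> \<in> dfl_simplices G n"
    "face i \<sigma> \<in> dfl_simplices G (n - 1)" "i < j" "j \<le> n" "face i \<sigma> = face j \<tau>"
  shows "(Tuple \<sigma>, Tuple \<tau>) \<in> parcs (path_digraph n G)"
  using assms by (auto simp: path_digraph_def)

lemma path_morphism_0 [simp]: "path_morphism 0 G H \<phi> = \<phi>"
  by (simp add: path_morphism_def)

lemma path_morphism_eq:
  "n \<noteq> 0 \<Longrightarrow> path_morphism n G H \<phi> =
    (\<lambda>v \<in> Tuple ` dfl_simplices G n. Tuple (map \<phi> (entries v)))"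
  by (simp add: path_morphism_def pverts_path_digraph)

lemma pair_digraph_path_digraph:
  assumes "pair_digraph G"
  shows "pair_digraph (path_digraph n G)"
proof (cases "n = 0")
  case False
  interpret pair_digraph G by fact
  let ?P = "path_digraph n G"
  have verts: "v \<in> pverts ?P" "w \<in> pverts ?P" if "(v, w) \<in> parcs ?P" for v w
    using False that by (auto simp: path_digraph_def)
  have fin: "finite (pverts ?P)"
    using False pair_finite_verts by (simp add: pverts_path_digraph finite_dfl_simplices)
  have loopfree: "v \<noteq> w" if arc: "(v, w) \<in> parcs ?P" for v w
    using False arc
  proof (rule path_digraph_arcE)
    fix \<sigma> \<tau> i j
    assume vw: "v = Tuple \<sigma>" "w = Tuple \<tau>" and \<sigma>: "\<sigma> \<in> dfl_simplices G n"
      and ij: "i < j" "j \<le> n" and eq: "face i \<sigma> = face j \<tau>"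
    show "v \<noteq> w"
    proof
      assume "v = w"
      \<comment> \<open>Position i tells the two faces apart: deleting entry i shifts entry
        \<open>Suc i\<close> into it, while deleting the later entry j leaves it alone. Equality
        would turn the arc between these entries into a loop.\<close>
      then have "face i \<sigma> ! i = face j \<sigma> ! i" using vw eq by simp
      then have "\<sigma> ! Suc i = \<sigma> ! i"
        using ij by (simp add: nth_face length_dfl_simplex[OF \<sigma>])
      moreover have "(\<sigma> ! i, \<sigma> ! Suc i) \<in> parcs G"
        using ij by (intro dfl_simplex_arc[OF \<sigma>]) auto
      ultimately show False using pair_no_loops by fastforce
    qed
  qed
  have "finite (parcs ?P)"
    using verts by (intro finite_subset[OF _ finite_cartesian_product[OF fin fin]]) auto
  then show ?thesis
    using verts fin loopfree by unfold_locales auto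
qed (use assms in simp)

lemma acyclic_path_digraph:
  assumes "pair_digraph G" "acyclic (parcs G)"
  shows "acyclic (parcs (path_digraph n G))"
proof (cases "n = 0")
  case False
  interpret pair_digraph G by fact
  obtain h :: "'a vertex \<Rightarrow> nat" where h: "\<And>v w. (v, w) \<in> parcs G \<Longrightarrow> h v < h w"
    using finite_acyclic_imp_potential[OF pair_finite_arcs assms(2)] by blast
  show ?thesis
  proof (rule potential_imp_acyclic)
    fix v w assume "(v, w) \<in> parcs (path_digraph n G)"
    \<comment> \<open>\<open>entries\<close> is unspecified on an \<open>Atom\<close>, but for
      positive n all arcs join \<open>Tuple\<close> vertices.\<close>
    with False show "sum_list (map h (entries v)) < sum_list (map h (entries w))"
    proof (rule path_digraph_arcE)
      fix \<sigma> \<tau> i j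
      assume vw: "v = Tuple \<sigma>" "w = Tuple \<tau>"
        and \<sigma>: "\<sigma> \<in> dfl_simplices G n" and \<tau>: "\<tau> \<in> dfl_simplices G n"
        and ij: "i < j" "j \<le> n" and eq: "face i \<sigma> = face j \<tau>"
      have len: "length \<sigma> = Suc n" "length \<tau> = Suc n"
        using \<sigma> \<tau> by (simp_all add: length_dfl_simplex)
      \<comment> \<open>Position \<open>j - 1\<close> lies at or after the gap in
        \<open>face i \<sigma>\<close> but before the gap in \<open>face j \<tau>\<close>;
        \<open>i < j\<close> ensures \<open>Suc (j - 1) = j\<close>.\<close>
      have "\<sigma> ! j = face i \<sigma> ! (j - 1)"
        using ij len by (auto simp: nth_face)
      also have "\<dots> = \<tau> ! (j - 1)"
        using ij len eq by (simp add: nth_face)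
      finally have "(\<sigma> ! j, \<tau> ! j) \<in> parcs G"
        using ij dfl_simplex_arc[OF \<tau>, of "j - 1" j] by simp
      moreover have "(\<sigma> ! i, \<sigma> ! j) \<in> parcs G"
        using ij by (rule dfl_simplex_arc[OF \<sigma>])
      ultimately have "h (\<sigma> ! i) < h (\<tau> ! j)"
        using h less_trans by blast
      then show ?thesis
        using vw ij len eq sum_list_map_face[of i \<sigma> h] sum_list_map_face[of j \<tau> h] by simp
    qed
  qed
qed (use assms in simp)

text \<open>Faces commute with applying \<phi> entrywise (\<open>face_map\<close>), so the indices i
  and j that witness an arc also witness its image.\<close>

lemma path_morphism_in_digraph_hom:
  assumes \<phi>: "\<phi> \<in> digraph_hom G H"
  shows "path_morphism n G H \<phi> \<in> digraph_hom (path_digraph n G) (path_digraph n H)"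
proof (cases "n = 0")
  case False
  show ?thesis
  proof (rule digraph_homI)
    show "path_morphism n G H \<phi> \<in> pverts (path_digraph n G) \<rightarrow>\<^sub>E pverts (path_digraph n H)"
      using False map_dfl_simplex[OF \<phi>] by (auto simp: path_morphism_eq pverts_path_digraph)
  next
    fix v w assume "(v, w) \<in> parcs (path_digraph n G)"
    with False
    show "(path_morphism n G H \<phi> v, path_morphism n G H \<phi> w) \<in> parcs (path_digraph n H)"
    proof (rule path_digraph_arcE)
      fix \<sigma> \<tau> i j
      assume vw: "v = Tuple \<sigma>" "w = Tuple \<tau>"
        and \<sigma>: "\<sigma> \<in> dfl_simplices G n" and \<tau>: "\<tau> \<in> dfl_simplices G n"
        and face: "face i \<sigma> \<in> dfl_simplices G (n - 1)"
        and ij: "i < j" "j \<le> n" and eq: "face i \<sigma> = face j \<tau>"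
      have "(Tuple (map \<phi> \<sigma>), Tuple (map \<phi> \<tau>)) \<in> parcs (path_digraph n H)"
        by (rule path_digraph_arcI[OF False _ _ _ ij])
          (simp_all only: face_map map_dfl_simplex[OF \<phi>] \<sigma> \<tau> face eq[symmetric])
      then show ?thesis
        using False vw \<sigma> \<tau> by (simp add: path_morphism_eq)
    qed
  qed
qed (use \<phi> in simp)

lemma path_morphism_id:
  "path_morphism n G G (\<lambda>v\<in>pverts G. v) = (\<lambda>v\<in>pverts (path_digraph n G). v)"
proof (cases "n = 0")
  case False
  \<comment> \<open>The restricted identity acts as the identity here because entries of simplices
    are vertices.\<close>
  have "map (\<lambda>v\<in>pverts G. v) \<sigma> = \<sigma>" if "\<sigma> \<in> dfl_simplices G n" for \<sigma>
    using that by (intro map_idI) (auto simp: dfl_simplices_def)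
  then show ?thesis
    using False by (auto simp: path_morphism_eq pverts_path_digraph simp del: restrict_apply
        intro!: restrict_ext)
qed simp

lemma path_morphism_compose:
  assumes \<phi>: "\<phi> \<in> digraph_hom G H"
  shows "path_morphism n G K (compose (pverts G) \<psi> \<phi>) =
    compose (pverts (path_digraph n G)) (path_morphism n H K \<psi>) (path_morphism n G H \<phi>)"
proof (cases "n = 0")
  case False
  have "map (compose (pverts G) \<psi> \<phi>) \<sigma> = map \<psi> (map \<phi> \<sigma>)" if "\<sigma> \<in> dfl_simplices G n" for \<sigma>
    using that by (auto simp: dfl_simplices_def compose_def)
  then show ?thesis
    \<comment> \<open>\<open>map_dfl_simplex\<close> puts the image tuple into the domain of the
      second path morphism. Only the outer composition is unfolded and \<open>map_map\<close> is
      disabled, so that the equation just proved can rewrite the inner one.\<close>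
    using False map_dfl_simplex[OF \<phi>, of _ n]
    by (auto simp: path_morphism_eq pverts_path_digraph compose_def[of "Tuple ` _"]
        simp del: map_map intro!: restrict_ext)
qed simp

lemma category_functor_path_digraph:
  "category_functor Digraph Digraph (path_digraph n) (path_morphism n)"
  unfolding category_functor_def category_functor_axioms_def
  by (auto simp: category_Digraph pair_digraph_path_digraph path_morphism_in_digraph_hom
      path_morphism_id path_morphism_compose)

theorem proposition3p23:
  fixes n :: nat
  shows "category_functor
      (Digraph :: ('a vertex pair_pre_digraph, 'a vertex \<Rightarrow> 'a vertex) category_data) Digraph
      (path_digraph n) (path_morphism n) \<and>
    category_functor
      (Digraph0 :: ('a vertex pair_pre_digraph, 'a vertex \<Rightarrow> 'a vertex) category_data) Digraph0
      (path_digraph n) (path_morphism n)"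
proof
  interpret category_functor
    "Digraph :: ('a vertex pair_pre_digraph, 'a vertex \<Rightarrow> 'a vertex) category_data" Digraph
    "path_digraph n" "path_morphism n"
    by (rule category_functor_path_digraph)
  show "category_functor
      (Digraph :: ('a vertex pair_pre_digraph, 'a vertex \<Rightarrow> 'a vertex) category_data) Digraph
      (path_digraph n) (path_morphism n)"
    by (rule category_functor_path_digraph)
  show "category_functor
      (Digraph0 :: ('a vertex pair_pre_digraph, 'a vertex \<Rightarrow> 'a vertex) category_data) Digraph0
      (path_digraph n) (path_morphism n)"
    unfolding Digraph0_def
  proof (rule category_functor_full_subcategory)
    fix G :: "'a vertex pair_pre_digraph"
    assume "G \<in> Ob Digraph" and acyclic: "\<not> has_oriented_cycle G"
    then have G: "pair_digraph G" by simp
    interpret G: pair_digraph G by (rule G)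
    \<comment> \<open>The acyclicity criterion holds for well-formed digraphs, so the path digraph
      must be known to be one first.\<close>
    interpret P: pair_digraph "path_digraph n G" by (rule pair_digraph_path_digraph[OF G])
    show "\<not> has_oriented_cycle (path_digraph n G)"
      using acyclic acyclic_path_digraph[OF G]
      by (simp add: G.has_oriented_cycle_iff P.has_oriented_cycle_iff)
  qed
qed

end
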